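(* Let $F$ and $G$ be strongly convex with moduli $\gamma_1>0$ and $\gamma_2>0$, respectively. Then the iteration (aDR$^{sc}$) converges R-linearly to the unique saddle-point $(x^*,y^* )$ of $L$ in the following sense: $$\lim_{k\to\infty}(x^k,y^k)=(x^*,y^* ),\qquad \|x^k-x^*\|^2=o(\vartheta^k),\qquad \|y^k-y^*\|^2=o(\vartheta^k).$$ Furthermore, denoting $\bar x^*=x^*-\sigma K^*y^*$ and $\bar y^*=y^*+\tau Kx^*$, $$\lim_{k\to\infty}(\bar x^k,\bar y^k)=(\bar x^*,\bar y^* ),\qquad \|\bar x^k-\bar x^*\|^2=o(\vartheta^k),\qquad \|\bar y^k-\bar y^*\|^2=o(\vartheta^k).$$
   Context: $X,Y$ are real Hilbert spaces, $K:X\to Y$ is linear and continuous with adjoint $K^*$, and $F:X\to(-\infty,\infty]$, $G:Y\to(-\infty,\infty]$ are proper, convex and lower semi-continuous. $L(x,y)=\langle Kx,y\rangle+F(x)-G(y)$ on $\operatorname{dom}F\times\operatorname{dom}G$; a saddle-point is $(x^*,y^* )\in\operatorname{dom}F\times\operatorname{dom}G$ with $L(x^*,y)\le L(x^*,y^* )\le L(x,y^* )$ for all $(x,y)\in\operatorname{dom}F\times\operatorname{dom}G$. $F$ is strongly convex with modulus $\gamma_1$ if $F(\lambda x+(1-\lambda)\bar x)\le\lambda F(x)+(1-\lambda)F(\bar x)-\gamma_1\lambda(1-\lambda)\|x-\bar x\|^2/2$ for all $x,\bar x\in\operatorname{dom}F$, $\lambda\in[0,1]$; analogously for $G$ with $\gamma_2$.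 Iteration (aDR$^{sc}$): choose $(\bar x^0,\bar y^0)\in X\times Y$, step sizes $\sigma,\tau>0$ with $\sigma\gamma_1=\tau\gamma_2$, an acceleration factor $0<\gamma\le\frac{2\gamma_1}{1+(1+2\sigma\gamma_1)\sigma\tau\|K\|^2}$, and $\vartheta=\frac1{1+\sigma\gamma}$. For $k\ge0$ set $x^{k+1}=(\mathrm{id}+\sigma\partial F)^{-1}(\bar x^k)$, $y^{k+1}=(\mathrm{id}+\tau\partial G)^{-1}(\bar y^k)$, $b^{k+1}=(\frac{1+\vartheta}{\vartheta}x^{k+1}-\bar x^k)-\vartheta\sigma K^*(\frac{1+\vartheta}{\vartheta}y^{k+1}-\bar y^k)$, $d^{k+1}=(\mathrm{id}+\vartheta^2\sigma\tau K^*K)^{-1}b^{k+1}$, $\bar x^{k+1}=\bar x^k-\vartheta^{-1}x^{k+1}+d^{k+1}$, $\bar y^{k+1}=y^{k+1}+\vartheta\tau Kd^{k+1}$. Equivalently, the last updates solve $\bar x^{k+1}=x^{k+1}-\sigma K^*[y^{k+1}+\vartheta(\bar y^{k+1}-\bar y^k)]$, $\bar y^{k+1}=y^{k+1}+\tau K[x^{k+1}+\vartheta(\bar x^{k+1}-\bar x^k)]$. Here $(\mathrm{id}+\sigma\partial F)^{-1}$ denotes the resolvent (proximal map) of the subdifferential. *)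

theory Defs
  imports "HOL-Analysis.Analysis" "HOL-Library.Landau_Symbols"
begin

text \<open>Convex analysis for extended real-valued functionals\<close>

definition proper_fun :: "('a \<Rightarrow> ereal) \<Rightarrow> bool" where
  "proper_fun F \<longleftrightarrow> (\<forall>x. F x \<noteq> -\<infinity>) \<and> (\<exists>x. F x \<noteq> \<infinity>)"

definition eff_dom :: "('a \<Rightarrow> ereal) \<Rightarrow> 'a set" where
  "eff_dom F = {x. F x < \<infinity>}"

text \<open>The cases \<open>t = 0\<close> and \<open>t = 1\<close> are harmless because \<open>0 * \<infinity> = 0\<close> in \<^typ>\<open>ereal\<close>.\<close>

definition convex_fun :: "('a::real_vector \<Rightarrow> ereal) \<Rightarrow> bool" where
  "convex_fun F \<longleftrightarrow>
     (\<forall>x y. \<forall>t\<in>{0..1::real}.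
        F (t *\<^sub>R x + (1 - t) *\<^sub>R y) \<le> ereal t * F x + ereal (1 - t) * F y)"

definition lsc_fun :: "('a::topological_space \<Rightarrow> ereal) \<Rightarrow> bool" where
  "lsc_fun F \<longleftrightarrow> (\<forall>x. F x \<le> Liminf (at x) F)"

definition strongly_convex_fun :: "('a::real_normed_vector \<Rightarrow> ereal) \<Rightarrow> real \<Rightarrow> bool" where
  "strongly_convex_fun F \<mu> \<longleftrightarrow>
     (\<forall>x\<in>eff_dom F. \<forall>y\<in>eff_dom F. \<forall>t\<in>{0..1::real}.
        F (t *\<^sub>R x + (1 - t) *\<^sub>R y)
          \<le> ereal t * F x + ereal (1 - t) * F y - ereal (\<mu> * t * (1 - t) * (norm (x - y))\<^sup>2 / 2))"

definition subdifferential :: "('a::real_inner \<Rightarrow> ereal) \<Rightarrow> 'a \<Rightarrow> 'a set" where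
  "subdifferential F x = {v. x \<in> eff_dom F \<and> (\<forall>z. F x + ereal (v \<bullet> (z - x)) \<le> F z)}"

text \<open>The resolvent \<open>(id + s \<partial>F)\<inverse>\<close> as a single-valued map: the unique \<open>x\<close> with
  \<open>z \<in> x + s \<partial>F(x)\<close>. That it exists and is unique on a Hilbert space, for \<open>s > 0\<close> and \<open>F\<close>
  proper, convex and lower semi-continuous, is not part of the definition.\<close>

definition resolvent :: "real \<Rightarrow> ('a::real_inner \<Rightarrow> ereal) \<Rightarrow> 'a \<Rightarrow> 'a" where
  "resolvent s F z = (THE x. \<exists>v\<in>subdifferential F x. z = x + s *\<^sub>R v)"

text \<open>The saddle-point functional is only meaningful on \<open>eff_dom F \<times> eff_dom G\<close>, where for proper
  \<open>F\<close>, \<open>G\<close> it is finite.\<close>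

definition Lfun ::
  "('a \<Rightarrow> 'b::real_inner) \<Rightarrow> ('a \<Rightarrow> ereal) \<Rightarrow> ('b \<Rightarrow> ereal) \<Rightarrow> 'a \<Rightarrow> 'b \<Rightarrow> ereal" where
  "Lfun K F G x y = ereal (K x \<bullet> y) + F x - G y"

definition saddle_point ::
  "('a \<Rightarrow> 'b::real_inner) \<Rightarrow> ('a \<Rightarrow> ereal) \<Rightarrow> ('b \<Rightarrow> ereal) \<Rightarrow> 'a \<Rightarrow> 'b \<Rightarrow> bool" where
  "saddle_point K F G xs ys \<longleftrightarrow>
     xs \<in> eff_dom F \<and> ys \<in> eff_dom G \<and>
     (\<forall>x\<in>eff_dom F. \<forall>y\<in>eff_dom G.
        Lfun K F G xs y \<le> Lfun K F G xs ys \<and> Lfun K F G xs ys \<le> Lfun K F G x ys)"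

text \<open>The accelerated Douglas--Rachford iteration for the strongly convex case. The starting values
  \<open>xb 0\<close>, \<open>yb 0\<close> are arbitrary; the entries \<open>x 0\<close>, \<open>y 0\<close>, \<open>b 0\<close>, \<open>d 0\<close> are never used.\<close>

definition aDRsc_iteration ::
  "('a::real_inner \<Rightarrow> 'b::real_inner) \<Rightarrow> ('a \<Rightarrow> ereal) \<Rightarrow> ('b \<Rightarrow> ereal) \<Rightarrow> real \<Rightarrow> real \<Rightarrow> real \<Rightarrow>
   (nat \<Rightarrow> 'a) \<Rightarrow> (nat \<Rightarrow> 'b) \<Rightarrow> (nat \<Rightarrow> 'a) \<Rightarrow> (nat \<Rightarrow> 'b) \<Rightarrow> (nat \<Rightarrow> 'a) \<Rightarrow> (nat \<Rightarrow> 'a) \<Rightarrow> bool" where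
  "aDRsc_iteration K F G \<sigma> \<tau> \<theta> x y xb yb b d \<longleftrightarrow>
     (\<forall>k.
        x (Suc k) = resolvent \<sigma> F (xb k) \<and>
        y (Suc k) = resolvent \<tau> G (yb k) \<and>
        b (Suc k) = (((1 + \<theta>) / \<theta>) *\<^sub>R x (Suc k) - xb k)
                    - (\<theta> * \<sigma>) *\<^sub>R adjoint K (((1 + \<theta>) / \<theta>) *\<^sub>R y (Suc k) - yb k) \<and>
        d (Suc k) = inv (\<lambda>u. u + (\<theta>\<^sup>2 * \<sigma> * \<tau>) *\<^sub>R adjoint K (K u)) (b (Suc k)) \<and>
        xb (Suc k) = xb k - (1 / \<theta>) *\<^sub>R x (Suc k) + d (Suc k) \<and>
        yb (Suc k) = y (Suc k) + (\<theta> * \<tau>) *\<^sub>R K (d (Suc k)))"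

end

theory Submission
  imports Defs
begin

text \<open>
  The proof rests on an energy that decays geometrically. Let \<open>(xs, ys)\<close> be the saddle-point, so that
  \<open>xs\<close> and \<open>ys\<close> are the resolvents of \<open>xbs = xs - \<sigma> K\<^sup>* ys\<close> and \<open>ybs = ys + \<tau> K xs\<close>. Put
  \<open>Z\<^sub>k = (xb k - xbs, yb k - ybs)\<close> and \<open>z\<^sub>k = (x (k+1) - xs, y (k+1) - ys)\<close>, measured in the norm
  \<open>\<parallel>(u, v)\<parallel>\<^sup>2 = \<parallel>u\<parallel>\<^sup>2/\<sigma> + \<parallel>v\<parallel>\<^sup>2/\<tau>\<close>. A step enters through two facts. Since \<open>\<sigma>\<gamma>\<^sub>1 = \<tau>\<gamma>\<^sub>2 =: \<mu>\<close>, the strong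
  monotonicity of the subdifferentials becomes \<open>\<langle>Z\<^sub>k - z\<^sub>k, z\<^sub>k\<rangle> \<ge> \<mu>\<parallel>z\<^sub>k\<parallel>\<^sup>2\<close>. Since the coupling of the
  two components by \<open>K\<close> and \<open>K\<^sup>*\<close> is skew, the linear updates say that \<open>Z\<^sub>k\<^sub>+\<^sub>1 - z\<^sub>k\<close> is orthogonal to
  \<open>z\<^sub>k + \<theta>(Z\<^sub>k\<^sub>+\<^sub>1 - Z\<^sub>k)\<close> and bounded by it through \<open>\<parallel>K\<parallel>\<close>. Young's inequality and the
  restriction on \<open>\<gamma>\<close> then give (\<open>energy_decay\<close>, \<open>aDRsc_energy_decay\<close>)
  \<open>\<parallel>Z\<^sub>k\<^sub>+\<^sub>1\<parallel>\<^sup>2/\<theta> + (1 - \<theta>\<^sup>2)\<parallel>Z\<^sub>k\<^sub>+\<^sub>1 - Z\<^sub>k\<parallel>\<^sup>2 \<le> \<parallel>Z\<^sub>k\<parallel>\<^sup>2\<close>.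

  Hence \<open>r\<^sub>k = \<parallel>Z\<^sub>k\<parallel> \<theta>\<^bsup>-k/2\<^esup>\<close> decreases to a limit \<open>r\<close>, and the differences \<open>Z\<^sub>k\<^sub>+\<^sub>1 - Z\<^sub>k\<close> are
  \<open>o(\<theta>\<^bsup>k/2\<^esup>)\<close>. The triangle inequality \<open>\<parallel>Z\<^sub>k\<parallel> \<le> \<parallel>Z\<^sub>k\<^sub>+\<^sub>1\<parallel> + \<parallel>Z\<^sub>k\<^sub>+\<^sub>1 - Z\<^sub>k\<parallel>\<close> gives \<open>r \<le> \<surd>\<theta> r\<close> in the limit,
  so \<open>r = 0\<close> (\<open>energy_decay_imp_little_o\<close>); this is what turns \<open>O(\<theta>\<^sup>k)\<close> into \<open>o(\<theta>\<^sup>k)\<close>. Resolvents are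
  nonexpansive, so \<open>x\<close> and \<open>y\<close> inherit the rate.

  All existence questions reduce to one: a proper convex lower semi-continuous function plus half the
  squared distance to a point has a minimizer in a complete space (\<open>prox_minimizer_exists\<close>). This makes
  the resolvents meaningful; applied to a continuous linear functional it yields the Riesz
  representation and with it the adjoint; applied to \<open>c\<parallel>K u\<parallel>\<^sup>2/2\<close> it solves
  \<open>u + c K\<^sup>* K u = z\<close>. The saddle-point itself is a fixed point of the map
  \<open>(x, y) \<mapsto> (resolvent s F (x - s K\<^sup>* y), resolvent s G (y + s K x))\<close>, which is a contraction for small
  \<open>s\<close> by strong convexity (\<open>saddle_point_exists\<close>).
\<close>

section \<open>Minimizers of strongly convex functions\<close>

text \<open>The derivative test at a minimum: it extracts an optimality condition from a comparison of
  values along a segment, the second-order term being negligible for small \<open>t\<close>.\<close>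
lemma first_order_nonneg:
  fixes a c :: real
  assumes "\<And>t. 0 < t \<Longrightarrow> t \<le> 1 \<Longrightarrow> 0 \<le> t * a + t\<^sup>2 * c"
  shows "0 \<le> a"
proof -
  have "eventually (\<lambda>t::real. 0 \<le> a + t * c) (at_right 0)"
    unfolding eventually_at_right_field
  proof (intro exI[of _ 1] conjI allI impI)
    fix t :: real assume t: "0 < t" "t < 1"
    then have "0 \<le> t * (a + t * c)"
      using assms[of t] by (simp add: algebra_simps power2_eq_square)
    then show "0 \<le> a + t * c" using t by (simp add: zero_le_mult_iff)
  qed simp
  moreover have "((\<lambda>t::real. a + t * c) \<longlongrightarrow> a + 0 * c) (at_right 0)"
    by (intro tendsto_intros)
  ultimately show ?thesis
    using tendsto_lowerbound[of "\<lambda>t. a + t * c" a "at_right 0" 0] by simp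
qed

text \<open>The sublevel sets just above the infimum are closed and nested. Two points of such a set have a
  midpoint whose value is not below the infimum, so by the convexity gap they are close to each other:
  the diameters shrink to zero, and completeness provides a common point.\<close>
lemma minimizer_exists:
  fixes \<phi> :: "'a::{real_normed_vector,complete_space} \<Rightarrow> real"
  assumes "D \<noteq> {}" and "m > 0"
    and mid: "\<And>x y. x \<in> D \<Longrightarrow> y \<in> D \<Longrightarrow> midpoint x y \<in> D"
    and convex: "\<And>x y. x \<in> D \<Longrightarrow> y \<in> D \<Longrightarrow>
        \<phi> (midpoint x y) \<le> (\<phi> x + \<phi> y) / 2 - m * (dist x y)\<^sup>2"
    and bdd: "\<And>x. x \<in> D \<Longrightarrow> B \<le> \<phi> x"
    and closed: "\<And>c. closed {x \<in> D. \<phi> x \<le> c}"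
  obtains u where "u \<in> D" "\<And>x. x \<in> D \<Longrightarrow> \<phi> u \<le> \<phi> x"
proof -
  define I where "I = Inf (\<phi> ` D)"
  have bb: "bdd_below (\<phi> ` D)" by (rule bdd_belowI2) (rule bdd)
  have I_le: "I \<le> \<phi> x" if "x \<in> D" for x
    unfolding I_def using that bb by (simp add: cINF_lower)
  define S where "S n = {x \<in> D. \<phi> x \<le> I + inverse (real (Suc n))}" for n
  have "S n \<noteq> {}" for n
  proof -
    have "Inf (\<phi> ` D) < I + inverse (real (Suc n))" by (simp add: I_def)
    then obtain x where "x \<in> D" "\<phi> x < I + inverse (real (Suc n))"
      using cInf_lessD[of "\<phi> ` D"] \<open>D \<noteq> {}\<close> by blast
    then show ?thesis by (auto simp: S_def intro: less_imp_le)
  qed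
  moreover have "closed (S n)" for n unfolding S_def by (rule closed)
  moreover have "S n \<subseteq> S k" if "k \<le> n" for k n
  proof -
    have "inverse (real (Suc n)) \<le> inverse (real (Suc k))"
      using that by (simp add: field_simps)
    then show ?thesis unfolding S_def by (blast intro: order_trans add_left_mono)
  qed
  moreover have "\<exists>n. \<forall>x\<in>S n. \<forall>y\<in>S n. dist x y < e" if "e > 0" for e
  proof -
    have "m * e\<^sup>2 > 0" using \<open>m > 0\<close> \<open>e > 0\<close> by simp
    then obtain n where n: "inverse (real (Suc n)) < m * e\<^sup>2"
      using reals_Archimedean by blast
    have "dist x y < e" if "x \<in> S n" "y \<in> S n" for x y
    proof -
      have xy: "x \<in> D" "y \<in> D" using that by (auto simp: S_def)
      have "I \<le> (\<phi> x + \<phi> y) / 2 - m * (dist x y)\<^sup>2"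
        using I_le[OF mid[OF xy]] convex[OF xy] by linarith
      also have "(\<phi> x + \<phi> y) / 2 \<le> I + inverse (real (Suc n))"
        using that by (simp add: S_def)
      finally have "m * (dist x y)\<^sup>2 < m * e\<^sup>2" using n by linarith
      then have "(dist x y)\<^sup>2 < e\<^sup>2" using \<open>m > 0\<close> by simp
      then show ?thesis using \<open>e > 0\<close> by (simp add: power2_less_imp_less)
    qed
    then show ?thesis by blast
  qed
  ultimately obtain u where u: "\<And>n. u \<in> S n"
    using decreasing_closed_nest[of S] by metis
  have "\<phi> u \<le> I"
  proof (rule field_le_epsilon)
    fix e :: real assume "e > 0"
    then obtain n where "inverse (real (Suc n)) < e" using reals_Archimedean by blast
    then show "\<phi> u \<le> I + e" using u[of n] by (simp add: S_def)
  qed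
  moreover have "u \<in> D" using u[of 0] by (simp add: S_def)
  ultimately show ?thesis using that I_le by (meson order_trans)
qed

section \<open>Convex functions with values in the extended reals\<close>

lemma eff_dom_ereal_real:
  assumes "proper_fun F" "x \<in> eff_dom F"
  shows "F x = ereal (real_of_ereal (F x))"
  using assms by (cases "F x") (auto simp: proper_fun_def eff_dom_def)

lemma subdifferential_real:
  assumes "proper_fun F"
  shows "v \<in> subdifferential F x \<longleftrightarrow> x \<in> eff_dom F \<and>
    (\<forall>z\<in>eff_dom F. real_of_ereal (F x) + v \<bullet> (z - x) \<le> real_of_ereal (F z))"
proof (cases "x \<in> eff_dom F")
  case True
  have "F x + ereal (v \<bullet> (z - x)) \<le> F z \<longleftrightarrow>
      (z \<in> eff_dom F \<longrightarrow> real_of_ereal (F x) + v \<bullet> (z - x) \<le> real_of_ereal (F z))" for z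
  proof (cases "z \<in> eff_dom F")
    case zD: True
    obtain r s where "F x = ereal r" "F z = ereal s"
      using eff_dom_ereal_real[OF assms True] eff_dom_ereal_real[OF assms zD] by blast
    then show ?thesis using zD by simp
  next
    case False
    then show ?thesis by (simp add: eff_dom_def)
  qed
  then show ?thesis using True by (auto simp: subdifferential_def)
qed (simp add: subdifferential_def)

lemma strongly_convex_real:
  assumes F: "proper_fun F" "strongly_convex_fun F \<mu>"
    and x: "x \<in> eff_dom F" and y: "y \<in> eff_dom F" and t: "0 \<le> t" "t \<le> 1"
  shows "t *\<^sub>R x + (1 - t) *\<^sub>R y \<in> eff_dom F"
    and "real_of_ereal (F (t *\<^sub>R x + (1 - t) *\<^sub>R y)) \<le>
      t * real_of_ereal (F x) + (1 - t) * real_of_ereal (F y)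
      - \<mu> * t * (1 - t) * (norm (x - y))\<^sup>2 / 2"
proof -
  let ?w = "t *\<^sub>R x + (1 - t) *\<^sub>R y"
  obtain r s where rs: "F x = ereal r" "F y = ereal s"
    using eff_dom_ereal_real[OF F(1) x] eff_dom_ereal_real[OF F(1) y] by blast
  have "F ?w \<le> ereal t * F x + ereal (1 - t) * F y
      - ereal (\<mu> * t * (1 - t) * (norm (x - y))\<^sup>2 / 2)"
    using F(2) x y t unfolding strongly_convex_fun_def by auto
  then have le: "F ?w \<le> ereal (t * r + (1 - t) * s - \<mu> * t * (1 - t) * (norm (x - y))\<^sup>2 / 2)"
    using rs by simp
  then show w: "?w \<in> eff_dom F" by (auto simp: eff_dom_def intro: le_less_trans)
  then obtain q where "F ?w = ereal q" using eff_dom_ereal_real[OF F(1) w] by blast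
  with le rs show "real_of_ereal (F ?w) \<le> t * real_of_ereal (F x) + (1 - t) * real_of_ereal (F y)
      - \<mu> * t * (1 - t) * (norm (x - y))\<^sup>2 / 2"
    by simp
qed

lemma convex_imp_strongly_convex_0:
  "convex_fun F \<Longrightarrow> strongly_convex_fun F 0"
  by (simp add: convex_fun_def strongly_convex_fun_def zero_ereal_def[symmetric])

lemma continuous_imp_lsc:
  assumes "\<And>x. (f \<longlongrightarrow> f x) (at x)"
  shows "lsc_fun (\<lambda>x. ereal (f x))"
  unfolding lsc_fun_def
proof
  fix x
  have "((\<lambda>x. ereal (f x)) \<longlongrightarrow> ereal (f x)) (at x)" by (rule tendsto_ereal[OF assms])
  from lim_imp_Liminf[OF _ this] show "ereal (f x) \<le> Liminf (at x) (\<lambda>x. ereal (f x))"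
    by (cases "at x = bot") simp_all
qed

lemma lsc_eventually_gt:
  assumes "lsc_fun F" "ereal r < F x"
  shows "\<forall>\<^sub>F y in nhds x. ereal r < F y"
proof -
  have "F x \<le> Liminf (at x) F" using assms(1) by (simp add: lsc_fun_def)
  then have "\<forall>\<^sub>F y in at x. ereal r < F y" using assms(2) by (simp add: le_Liminf_iff)
  then have "\<forall>\<^sub>F y in nhds x. y \<noteq> x \<longrightarrow> ereal r < F y" by (simp add: eventually_at_filter)
  then show ?thesis by (rule eventually_mono) (use assms(2) in auto)
qed

text \<open>Lower semi-continuity bounds \<open>F\<close> from below near one point \<open>x0\<close> of its domain. Convexity along the
  segment from \<open>x0\<close> to a distant \<open>x\<close> carries that bound outwards, at the price of a linear loss.
  This replaces the affine minorant that a separation theorem would give.\<close>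
lemma convex_lsc_linear_lower_bound:
  fixes F :: "'a::real_inner \<Rightarrow> ereal"
  assumes F: "proper_fun F" "convex_fun F" "lsc_fun F"
  obtains x0 a b where "b \<ge> 0" "\<And>x. x \<in> eff_dom F \<Longrightarrow> a - b * norm (x - x0) \<le> real_of_ereal (F x)"
proof -
  let ?f = "\<lambda>x. real_of_ereal (F x)"
  obtain x0 where x0: "x0 \<in> eff_dom F" using F(1) by (auto simp: proper_fun_def eff_dom_def)
  have "ereal (?f x0 - 1) < F x0" by (subst eff_dom_ereal_real[OF F(1) x0]) simp
  then have "\<forall>\<^sub>F y in nhds x0. ereal (?f x0 - 1) < F y" by (rule lsc_eventually_gt[OF F(3)])
  then obtain e where e: "e > 0" "\<And>y. dist y x0 < e \<Longrightarrow> ereal (?f x0 - 1) < F y"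
    unfolding eventually_nhds_metric by blast
  have near: "?f x0 - 1 < ?f y" if "y \<in> eff_dom F" "dist y x0 < e" for y
    using e(2)[OF that(2)] by (subst (asm) eff_dom_ereal_real[OF F(1) that(1)]) simp
  define r where "r = e / 2"
  have r: "r > 0" "r < e" using e by (auto simp: r_def)
  have "(?f x0 - 1) - (1 / r) * norm (x - x0) \<le> ?f x" if x: "x \<in> eff_dom F" for x
  proof (cases "norm (x - x0) \<le> r")
    case True
    then have "?f x0 - 1 < ?f x" using near[OF x] r by (simp add: dist_norm)
    moreover have "0 \<le> (1 / r) * norm (x - x0)" using r by simp
    ultimately show ?thesis by linarith
  next
    case False
    define n where "n = norm (x - x0)"
    define t where "t = r / n"
    have n: "n > r" "n > 0" using False r by (auto simp: n_def)
    have t: "0 < t" "t \<le> 1" using n r by (auto simp: t_def)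
    let ?w = "t *\<^sub>R x + (1 - t) *\<^sub>R x0"
    note sc = strongly_convex_real[OF F(1) convex_imp_strongly_convex_0[OF F(2)] x x0, of t]
    have w: "?w \<in> eff_dom F" using sc(1) t by simp
    have "?w - x0 = t *\<^sub>R (x - x0)" by (simp add: algebra_simps)
    then have "dist ?w x0 = t * n" using t by (simp add: dist_norm n_def)
    then have "dist ?w x0 < e" using n r by (simp add: t_def)
    then have "?f x0 - 1 < t * ?f x + (1 - t) * ?f x0"
      using near[OF w] sc(2) t by simp
    then have "t * (?f x0 - ?f x) \<le> 1" by (simp add: algebra_simps)
    then have "?f x0 - ?f x \<le> n / r" using n r by (simp add: t_def field_simps)
    then show ?thesis by (simp add: n_def)
  qed
  then show ?thesis using that[of "1 / r" "?f x0 - 1" x0] r by simp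
qed

section \<open>Subgradients and resolvents\<close>

lemma prox_minimizer_exists:
  fixes F :: "'a::{real_inner,complete_space} \<Rightarrow> ereal"
  assumes F: "proper_fun F" "convex_fun F" "lsc_fun F" and s: "s > 0"
  obtains u where "u \<in> eff_dom F" "\<And>x. x \<in> eff_dom F \<Longrightarrow>
     s * real_of_ereal (F u) + (norm (u - z))\<^sup>2 / 2 \<le> s * real_of_ereal (F x) + (norm (x - z))\<^sup>2 / 2"
proof -
  let ?f = "\<lambda>x. real_of_ereal (F x)"
  let ?\<phi> = "\<lambda>x. s * ?f x + (norm (x - z))\<^sup>2 / 2"
  have ne: "eff_dom F \<noteq> {}" using F(1) by (auto simp: proper_fun_def eff_dom_def)
  note sc = strongly_convex_real[OF F(1) convex_imp_strongly_convex_0[OF F(2)], of _ _ "1/2"]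
  have mp: "midpoint x y = (1/2) *\<^sub>R x + (1 - 1/2) *\<^sub>R y" for x y :: 'a
    by (simp add: midpoint_def scaleR_add_right)
  have mid: "midpoint x y \<in> eff_dom F" if "x \<in> eff_dom F" "y \<in> eff_dom F" for x y
    using sc(1)[OF that] by (simp add: mp)
  \<comment> \<open>Convexity of \<open>F\<close> contributes no gap; the parallelogram identity for the square supplies it.\<close>
  have cv: "?\<phi> (midpoint x y) \<le> (?\<phi> x + ?\<phi> y) / 2 - (1/8) * (dist x y)\<^sup>2"
    if "x \<in> eff_dom F" "y \<in> eff_dom F" for x y
  proof -
    have "?f (midpoint x y) \<le> (?f x + ?f y) / 2"
      using sc(2)[OF that] by (simp add: mp field_simps)
    then have "s * ?f (midpoint x y) \<le> (s * ?f x + s * ?f y) / 2"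
      using mult_left_mono[of "?f (midpoint x y)" "(?f x + ?f y) / 2" s] s
      by (simp add: distrib_left)
    moreover have "(norm (midpoint x y - z))\<^sup>2 =
        (norm (x - z))\<^sup>2 / 2 + (norm (y - z))\<^sup>2 / 2 - (dist x y)\<^sup>2 / 4"
      by (simp add: mp dist_norm power2_norm_eq_inner inner_diff_left inner_diff_right
          inner_add_left inner_add_right inner_commute field_simps)
    ultimately show ?thesis by (simp add: field_simps)
  qed
  obtain x0 a b where b: "b \<ge> 0"
      "\<And>x. x \<in> eff_dom F \<Longrightarrow> a - b * norm (x - x0) \<le> ?f x"
    by (rule convex_lsc_linear_lower_bound[OF F], rule that)
  \<comment> \<open>The square grows faster than the linear loss; the constant comes from
    \<open>0 \<le> (\<parallel>x - z\<parallel> - s b)\<^sup>2\<close>.\<close>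
  have bdd: "s * (a - b * norm (z - x0)) - (s * b)\<^sup>2 / 2 \<le> ?\<phi> x" if x: "x \<in> eff_dom F" for x
  proof -
    have "norm (x - x0) \<le> norm (x - z) + norm (z - x0)"
      using norm_triangle_ineq[of "x - z" "z - x0"] by simp
    then have "b * norm (x - x0) \<le> b * (norm (x - z) + norm (z - x0))"
      using b(1) by (rule mult_left_mono)
    then have "a - b * (norm (x - z) + norm (z - x0)) \<le> ?f x" using b(2)[OF x] by linarith
    then have "s * (a - b * (norm (x - z) + norm (z - x0))) \<le> s * ?f x"
      using s by simp
    moreover have "0 \<le> (norm (x - z) - s * b)\<^sup>2" by simp
    ultimately show ?thesis by (simp add: power2_diff algebra_simps)
  qed
  \<comment> \<open>A point outside the sublevel set has \<open>F\<close> above some real \<open>r\<close> that already makes the sum exceed \<open>c\<close>;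
    this covers points outside the domain as well.\<close>
  have cl: "closed {x \<in> eff_dom F. ?\<phi> x \<le> c}" for c
  proof -
    have "open (- {x \<in> eff_dom F. ?\<phi> x \<le> c})"
    proof (rule Topological_Spaces.openI)
      fix x assume x: "x \<in> - {x \<in> eff_dom F. ?\<phi> x \<le> c}"
      have "ereal ((c - (norm (x - z))\<^sup>2 / 2) / s) < F x"
      proof (cases "x \<in> eff_dom F")
        case True
        then have "c < ?\<phi> x" using x by auto
        then show ?thesis
          using s by (subst eff_dom_ereal_real[OF F(1) True]) (simp add: field_simps)
      qed (simp add: eff_dom_def)
      then obtain r where r: "(c - (norm (x - z))\<^sup>2 / 2) / s < r" "ereal r < F x"
        using ereal_dense2[of "ereal ((c - (norm (x - z))\<^sup>2 / 2) / s)"] by auto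
      have "((\<lambda>y. s * r + (norm (y - z))\<^sup>2 / 2) \<longlongrightarrow> s * r + (norm (x - z))\<^sup>2 / 2) (nhds x)"
        by (intro tendsto_intros) (auto simp: filterlim_ident)
      moreover have "c < s * r + (norm (x - z))\<^sup>2 / 2" using r(1) s by (simp add: field_simps)
      ultimately have "\<forall>\<^sub>F y in nhds x. c < s * r + (norm (y - z))\<^sup>2 / 2"
        by (rule order_tendstoD(1))
      with lsc_eventually_gt[OF F(3) r(2)]
      have "\<forall>\<^sub>F y in nhds x. y \<in> - {x \<in> eff_dom F. ?\<phi> x \<le> c}"
      proof eventually_elim
        case (elim y)
        show ?case
        proof (cases "y \<in> eff_dom F")
          case True
          have "r < ?f y" using elim(1) by (subst (asm) eff_dom_ereal_real[OF F(1) True]) simp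
          then have "s * r < s * ?f y" using s by simp
          then show ?thesis using elim(2) by auto
        qed auto
      qed
      then show "\<exists>T. open T \<and> x \<in> T \<and> T \<subseteq> - {x \<in> eff_dom F. ?\<phi> x \<le> c}"
        unfolding eventually_nhds by blast
    qed
    then show ?thesis by (simp add: closed_def)
  qed
  show ?thesis
    using minimizer_exists[of "eff_dom F" "1/8" ?\<phi>, OF ne _ mid cv bdd cl] that by auto
qed

text \<open>The first-order condition at the minimizer \<open>u\<close> of \<open>s F + \<parallel>\<cdot> - z\<parallel>\<^sup>2/2\<close> says that \<open>(z - u)/s\<close> is a
  subgradient of \<open>F\<close> at \<open>u\<close>.\<close>
lemma prox_subgradient_exists:
  fixes F :: "'a::{real_inner,complete_space} \<Rightarrow> ereal"
  assumes F: "proper_fun F" "convex_fun F" "lsc_fun F" and s: "s > 0"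
  obtains u v where "v \<in> subdifferential F u" "z = u + s *\<^sub>R v"
proof -
  let ?f = "\<lambda>x. real_of_ereal (F x)"
  obtain u where u: "u \<in> eff_dom F" "\<And>x. x \<in> eff_dom F \<Longrightarrow>
     s * ?f u + (norm (u - z))\<^sup>2 / 2 \<le> s * ?f x + (norm (x - z))\<^sup>2 / 2"
    using prox_minimizer_exists[OF F s] by metis
  have "?f u + ((1 / s) *\<^sub>R (z - u)) \<bullet> (w - u) \<le> ?f w" if w: "w \<in> eff_dom F" for w
  proof -
    have "0 \<le> s * (?f w - ?f u) + (u - z) \<bullet> (w - u)"
    proof (rule first_order_nonneg)
      fix t :: real assume t: "0 < t" "t \<le> 1"
      let ?w = "t *\<^sub>R w + (1 - t) *\<^sub>R u"
      note sc = strongly_convex_real[OF F(1) convex_imp_strongly_convex_0[OF F(2)] w u(1), of t]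
      have "s * ?f u + (norm (u - z))\<^sup>2 / 2 \<le> s * ?f ?w + (norm (?w - z))\<^sup>2 / 2"
        using u(2) sc(1) t by simp
      moreover have "s * ?f ?w \<le> s * (t * ?f w + (1 - t) * ?f u)" using sc(2) t s by simp
      moreover have "(norm (?w - z))\<^sup>2 =
          (norm (u - z))\<^sup>2 + 2 * t * ((u - z) \<bullet> (w - u)) + t\<^sup>2 * (norm (w - u))\<^sup>2"
      proof -
        have "?w - z = (u - z) + t *\<^sub>R (w - u)" by (simp add: algebra_simps)
        then show ?thesis
          by (simp only: power2_norm_eq_inner)
            (simp add: inner_add_left inner_add_right inner_commute power2_eq_square)
      qed
      ultimately show "0 \<le> t * (s * (?f w - ?f u) + (u - z) \<bullet> (w - u)) + t\<^sup>2 * ((norm (w - u))\<^sup>2 / 2)"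
        by (simp add: algebra_simps)
    qed
    then have "s * (?f u + ((1 / s) *\<^sub>R (z - u)) \<bullet> (w - u)) \<le> s * ?f w"
      using s by (simp add: algebra_simps inner_diff_left)
    then show ?thesis using s by simp
  qed
  then have "(1 / s) *\<^sub>R (z - u) \<in> subdifferential F u"
    using subdifferential_real[OF F(1)] u(1) by blast
  moreover have "z = u + s *\<^sub>R ((1 / s) *\<^sub>R (z - u))" using s by simp
  ultimately show ?thesis by (rule that)
qed

text \<open>A subgradient at \<open>x\<close> bounds the values on the segment from \<open>x\<close> to \<open>z\<close>; comparing this with the
  strong convexity bound near \<open>x\<close> reveals the quadratic term.\<close>
lemma strong_subgradient_inequality:
  assumes F: "proper_fun F" "strongly_convex_fun F \<mu>"
    and v: "v \<in> subdifferential F x" and z: "z \<in> eff_dom F"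
  shows "real_of_ereal (F x) + v \<bullet> (z - x) + \<mu> / 2 * (norm (z - x))\<^sup>2 \<le> real_of_ereal (F z)"
proof -
  let ?f = "\<lambda>x. real_of_ereal (F x)"
  have x: "x \<in> eff_dom F" using v by (simp add: subdifferential_def)
  have "0 \<le> ?f z - ?f x - v \<bullet> (z - x) - \<mu> / 2 * (norm (z - x))\<^sup>2"
  proof (rule first_order_nonneg)
    fix t :: real assume t: "0 < t" "t \<le> 1"
    let ?w = "t *\<^sub>R z + (1 - t) *\<^sub>R x"
    note sc = strongly_convex_real[OF F z x, of t]
    have "?f x + v \<bullet> (?w - x) \<le> ?f ?w" using v sc(1) t subdifferential_real[OF F(1)] by auto
    moreover have "?w - x = t *\<^sub>R (z - x)" by (simp add: algebra_simps)
    ultimately have "?f x + t * (v \<bullet> (z - x)) \<le> t * ?f z + (1 - t) * ?f x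
        - \<mu> * t * (1 - t) * (norm (z - x))\<^sup>2 / 2"
      using sc(2) t by simp
    then show "0 \<le> t * (?f z - ?f x - v \<bullet> (z - x) - \<mu> / 2 * (norm (z - x))\<^sup>2)
        + t\<^sup>2 * (\<mu> / 2 * (norm (z - x))\<^sup>2)"
      by (simp add: field_simps power2_eq_square)
  qed
  then show ?thesis by linarith
qed

lemma subdifferential_strongly_monotone:
  assumes F: "proper_fun F" "strongly_convex_fun F \<mu>"
    and v: "v \<in> subdifferential F x" and w: "w \<in> subdifferential F z"
  shows "\<mu> * (norm (x - z))\<^sup>2 \<le> (v - w) \<bullet> (x - z)"
proof -
  have D: "x \<in> eff_dom F" "z \<in> eff_dom F" using v w by (auto simp: subdifferential_def)
  show ?thesis
    using strong_subgradient_inequality[OF F v D(2)] strong_subgradient_inequality[OF F w D(1)]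
    by (simp add: norm_minus_commute inner_diff_left inner_diff_right)
qed

lemma resolvent_eqI:
  assumes F: "proper_fun F" "convex_fun F" and s: "s > 0"
    and v: "v \<in> subdifferential F u" "z = u + s *\<^sub>R v"
  shows "resolvent s F z = u"
  unfolding resolvent_def
proof (rule the_equality)
  fix u' assume "\<exists>v\<in>subdifferential F u'. z = u' + s *\<^sub>R v"
  then obtain v' where v': "v' \<in> subdifferential F u'" "z = u' + s *\<^sub>R v'" by blast
  have "0 \<le> (v - v') \<bullet> (u - u')"
    using subdifferential_strongly_monotone[OF F(1) convex_imp_strongly_convex_0[OF F(2)] v(1) v'(1)]
    by simp
  then have "0 \<le> (s *\<^sub>R (v - v')) \<bullet> (u - u')" using s by simp
  moreover have "s *\<^sub>R (v - v') = - (u - u')"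
    using v(2) v'(2) by (simp add: algebra_simps)
  ultimately have "(u - u') \<bullet> (u - u') \<le> 0"
    by (metis inner_minus_left neg_0_le_iff_le)
  then show "u' = u" by (metis inner_eq_zero_iff inner_ge_zero order_antisym right_minus_eq)
qed (use v in blast)

lemma resolvent_subgradient:
  fixes F :: "'a::{real_inner,complete_space} \<Rightarrow> ereal"
  assumes F: "proper_fun F" "convex_fun F" "lsc_fun F" and s: "s > 0"
  shows "(1 / s) *\<^sub>R (z - resolvent s F z) \<in> subdifferential F (resolvent s F z)"
proof -
  obtain u v where uv: "v \<in> subdifferential F u" "z = u + s *\<^sub>R v"
    using prox_subgradient_exists[OF F s] by metis
  then have "resolvent s F z = u" using resolvent_eqI F s by blast
  moreover have "(1 / s) *\<^sub>R (z - u) = v" using uv(2) s by simp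
  ultimately show ?thesis using uv(1) by simp
qed

text \<open>Strong monotonicity applied to the subgradients \<open>(z - resolvent s F z)/s\<close>. In this form the
  proximal steps enter the energy estimate.\<close>
lemma resolvent_strongly_monotone:
  fixes F :: "'a::{real_inner,complete_space} \<Rightarrow> ereal"
  assumes F: "proper_fun F" "convex_fun F" "lsc_fun F" "strongly_convex_fun F \<mu>" and s: "s > 0"
    and p: "p = resolvent s F z - resolvent s F w"
  shows "s * \<mu> * (norm p)\<^sup>2 \<le> (z - w - p) \<bullet> p"
proof -
  let ?r = "resolvent s F"
  have "\<mu> * (norm p)\<^sup>2 \<le> ((1 / s) *\<^sub>R (z - ?r z) - (1 / s) *\<^sub>R (w - ?r w)) \<bullet> p"
    unfolding p
    by (rule subdifferential_strongly_monotone[OF F(1,4)]) (rule resolvent_subgradient[OF F(1-3) s])+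
  also have "\<dots> = ((z - w - p) \<bullet> p) / s"
  proof -
    have "(1 / s) *\<^sub>R (z - ?r z) - (1 / s) *\<^sub>R (w - ?r w) = (1 / s) *\<^sub>R (z - w - p)"
      by (simp add: p scaleR_diff_right[symmetric])
    then show ?thesis by simp
  qed
  finally show ?thesis using s by (simp add: field_simps)
qed

lemma resolvent_contraction:
  fixes F :: "'a::{real_inner,complete_space} \<Rightarrow> ereal"
  assumes F: "proper_fun F" "convex_fun F" "lsc_fun F" "strongly_convex_fun F \<mu>" and s: "s > 0"
  shows "(1 + s * \<mu>) * norm (resolvent s F z - resolvent s F w) \<le> norm (z - w)"
proof -
  define p where "p = resolvent s F z - resolvent s F w"
  have "s * \<mu> * (norm p)\<^sup>2 \<le> (z - w - p) \<bullet> p"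
    by (rule resolvent_strongly_monotone[OF F s p_def])
  then have "(1 + s * \<mu>) * (norm p)\<^sup>2 \<le> (z - w) \<bullet> p"
    by (simp add: inner_diff_left power2_norm_eq_inner algebra_simps)
  also have "\<dots> \<le> norm (z - w) * norm p" by (rule norm_cauchy_schwarz)
  finally have "((1 + s * \<mu>) * norm p) * norm p \<le> norm (z - w) * norm p"
    by (simp add: power2_eq_square mult.assoc)
  then show ?thesis unfolding p_def[symmetric]
    by (cases "norm p = 0") auto
qed

section \<open>Adjoint operators\<close>

text \<open>The resolvent of the convex function \<open>- f\<close> at the origin is the representing vector: its
  subgradient inequality bounds \<open>f\<close> above by \<open>u \<bullet> _\<close>, and two linear functionals so ordered coincide.\<close>
lemma riesz_representation:
  fixes f :: "'a::{real_inner,complete_space} \<Rightarrow> real"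
  assumes "bounded_linear f"
  obtains a where "\<And>x. f x = a \<bullet> x"
proof -
  interpret f: bounded_linear f by fact
  define F where "F x = ereal (- f x)" for x
  have 1: "proper_fun F" by (auto simp: F_def proper_fun_def)
  have 2: "convex_fun F" by (auto simp: F_def convex_fun_def f.add f.scale)
  have 3: "lsc_fun F" unfolding F_def
    by (intro continuous_imp_lsc tendsto_minus f.tendsto tendsto_ident_at)
  obtain u v where uv: "v \<in> subdifferential F u" "0 = u + 1 *\<^sub>R v"
    using prox_subgradient_exists[OF 1 2 3, of 1] by (metis zero_less_one)
  then have v: "v = - u" by (simp add: eq_neg_iff_add_eq_0 add.commute)
  have le: "f h \<le> u \<bullet> h" for h
  proof -
    have "F u + ereal (v \<bullet> ((u + h) - u)) \<le> F (u + h)" using uv(1) by (simp only: subdifferential_def) blast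
    then show ?thesis by (simp add: F_def v f.add)
  qed
  have "f h = u \<bullet> h" for h using le[of h] le[of "- h"] by (simp add: f.neg)
  then show ?thesis by (rule that)
qed

lemma inner_adjoint:
  fixes K :: "'a::{real_inner,complete_space} \<Rightarrow> 'b::real_inner"
  assumes "bounded_linear K"
  shows "x \<bullet> adjoint K y = K x \<bullet> y"
proof -
  have "\<exists>a. \<forall>x. K x \<bullet> y = x \<bullet> a" for y
  proof -
    have "bounded_linear (\<lambda>x. K x \<bullet> y)"
      using bounded_linear_compose[OF bounded_linear_inner_left assms] .
    then show ?thesis by (metis riesz_representation inner_commute)
  qed
  then have "\<exists>K'. \<forall>x y. K x \<bullet> y = x \<bullet> K' y" by metis
  then have "\<forall>x y. K x \<bullet> y = x \<bullet> adjoint K y"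
    unfolding adjoint_def by (rule someI_ex)
  then show ?thesis by simp
qed

lemma
  fixes K :: "'a::{real_inner,complete_space} \<Rightarrow> 'b::real_inner"
  assumes K: "bounded_linear K"
  shows linear_adjoint: "linear (adjoint K)"
    and norm_adjoint_le: "norm (adjoint K y) \<le> onorm K * norm y"
proof -
  note ia = inner_adjoint[OF K]
  show "linear (adjoint K)"
  proof (rule linearI)
    show "adjoint K (y + z) = adjoint K y + adjoint K z" for y z
      by (rule vector_eq_ldot[THEN iffD1]) (simp add: ia inner_add_right)
    show "adjoint K (c *\<^sub>R y) = c *\<^sub>R adjoint K y" for c y
      by (rule vector_eq_ldot[THEN iffD1]) (simp add: ia)
  qed
  let ?a = "adjoint K y"
  have "norm ?a * norm ?a = K ?a \<bullet> y" by (metis ia power2_norm_eq_inner power2_eq_square)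
  also have "\<dots> \<le> norm (K ?a) * norm y" by (rule norm_cauchy_schwarz)
  also have "\<dots> \<le> onorm K * norm ?a * norm y"
    by (intro mult_right_mono onorm[OF K]) simp
  finally show "norm ?a \<le> onorm K * norm y"
    using onorm_pos_le[OF K] by (cases "norm ?a = 0") (auto simp: mult.assoc mult.left_commute)
qed

text \<open>The equation \<open>u + c K\<^sup>* K u = z\<close> is the optimality condition of the proximal problem for
  \<open>c\<parallel>K u\<parallel>\<^sup>2/2\<close>, so its solution is a resolvent.\<close>
lemma surj_id_plus_adjoint_comp:
  fixes K :: "'a::{real_inner,complete_space} \<Rightarrow> 'b::real_inner"
  assumes K: "bounded_linear K" and c: "c \<ge> 0"
  shows "surj (\<lambda>u. u + c *\<^sub>R adjoint K (K u))"
proof (unfold surj_def, rule allI)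
  interpret K: bounded_linear K by fact
  note ia = inner_adjoint[OF K]
  fix z
  define F where "F x = ereal (c / 2 * (norm (K x))\<^sup>2)" for x
  have expand: "(norm (K (u + h)))\<^sup>2 = (norm (K u))\<^sup>2 + 2 * (K u \<bullet> K h) + (norm (K h))\<^sup>2" for u h
    by (simp add: K.add power2_norm_eq_inner inner_add_left inner_add_right inner_commute)
  have 1: "proper_fun F" by (auto simp: F_def proper_fun_def)
  have 2: "convex_fun F"
    unfolding convex_fun_def
  proof (intro allI ballI)
    fix x y and t :: real assume t: "t \<in> {0..1}"
    have "(norm (K (t *\<^sub>R x + (1 - t) *\<^sub>R y)))\<^sup>2 =
        t * (norm (K x))\<^sup>2 + (1 - t) * (norm (K y))\<^sup>2 - t * (1 - t) * (norm (K x - K y))\<^sup>2"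
    proof -
      have "(norm (t *\<^sub>R p + (1 - t) *\<^sub>R q))\<^sup>2 =
          t * (norm p)\<^sup>2 + (1 - t) * (norm q)\<^sup>2 - t * (1 - t) * (norm (p - q))\<^sup>2" for p q :: 'b
        unfolding power2_norm_eq_inner inner_add_left inner_add_right inner_diff_left
          inner_diff_right inner_scaleR_left inner_scaleR_right inner_commute[of q p]
        by algebra
      then show ?thesis unfolding K.add K.scale .
    qed
    also have "\<dots> \<le> t * (norm (K x))\<^sup>2 + (1 - t) * (norm (K y))\<^sup>2" using t by simp
    finally have "c / 2 * (norm (K (t *\<^sub>R x + (1 - t) *\<^sub>R y)))\<^sup>2 \<le>
        c / 2 * (t * (norm (K x))\<^sup>2 + (1 - t) * (norm (K y))\<^sup>2)"
      using c by (intro mult_left_mono) auto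
    also have "\<dots> = t * (c / 2 * (norm (K x))\<^sup>2) + (1 - t) * (c / 2 * (norm (K y))\<^sup>2)"
      by algebra
    finally show "F (t *\<^sub>R x + (1 - t) *\<^sub>R y) \<le> ereal t * F x + ereal (1 - t) * F y"
      unfolding F_def times_ereal.simps plus_ereal.simps ereal_less_eq .
  qed
  have 3: "lsc_fun F" unfolding F_def
    by (intro continuous_imp_lsc tendsto_intros K.tendsto tendsto_ident_at)
  obtain u v where uv: "v \<in> subdifferential F u" "z = u + 1 *\<^sub>R v"
    using prox_subgradient_exists[OF 1 2 3, of 1] by (metis zero_less_one)
  have le: "v \<bullet> h \<le> c * (K u \<bullet> K h)" for h
  proof -
    have "0 \<le> c * (K u \<bullet> K h) - v \<bullet> h"
    proof (rule first_order_nonneg)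
      fix t :: real assume "0 < t" "t \<le> 1"
      have "F u + ereal (v \<bullet> ((u + t *\<^sub>R h) - u)) \<le> F (u + t *\<^sub>R h)"
        using uv(1) by (simp only: subdifferential_def) blast
      then have "c / 2 * (norm (K u))\<^sup>2 + t * (v \<bullet> h) \<le> c / 2 * (norm (K (u + t *\<^sub>R h)))\<^sup>2"
        by (simp add: F_def)
      then show "0 \<le> t * (c * (K u \<bullet> K h) - v \<bullet> h) + t\<^sup>2 * (c / 2 * (norm (K h))\<^sup>2)"
        unfolding expand by (simp add: K.scale algebra_simps power2_eq_square)
    qed
    then show ?thesis by simp
  qed
  have "v = c *\<^sub>R adjoint K (K u)"
  proof (rule vector_eq_ldot[THEN iffD1], rule allI)
    fix h
    show "h \<bullet> v = h \<bullet> (c *\<^sub>R adjoint K (K u))"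
      using le[of h] le[of "- h"] by (simp add: ia K.neg inner_commute)
  qed
  then show "\<exists>u. z = u + c *\<^sub>R adjoint K (K u)" using uv(2) by auto
qed

section \<open>Saddle-points\<close>

text \<open>With the other variable fixed at the saddle-point, each of the two inequalities is a subgradient
  inequality: the coupling term is linear in the free variable and \<open>K\<close> is moved to the other side of
  the inner product.\<close>
lemma saddle_point_iff_subgradients:
  fixes K :: "'a::{real_inner,complete_space} \<Rightarrow> 'b::real_inner"
  assumes K: "bounded_linear K" and F: "proper_fun F" and G: "proper_fun G"
  shows "saddle_point K F G xs ys \<longleftrightarrow>
    - adjoint K ys \<in> subdifferential F xs \<and> K xs \<in> subdifferential G ys"
proof (cases "xs \<in> eff_dom F \<and> ys \<in> eff_dom G")
  case True
  then have xs: "xs \<in> eff_dom F" and ys: "ys \<in> eff_dom G" by auto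
  let ?f = "\<lambda>x. real_of_ereal (F x)" and ?g = "\<lambda>y. real_of_ereal (G y)"
  have L: "Lfun K F G x y = ereal (K x \<bullet> y + ?f x - ?g y)"
    if "x \<in> eff_dom F" "y \<in> eff_dom G" for x y
    unfolding Lfun_def
    by (subst eff_dom_ereal_real[OF F that(1)], subst eff_dom_ereal_real[OF G that(2)]) simp
  have "saddle_point K F G xs ys \<longleftrightarrow>
      (\<forall>x\<in>eff_dom F. K xs \<bullet> ys + ?f xs \<le> K x \<bullet> ys + ?f x) \<and>
      (\<forall>y\<in>eff_dom G. K xs \<bullet> y - ?g y \<le> K xs \<bullet> ys - ?g ys)"
    using xs ys by (auto simp: saddle_point_def L)
  also have "\<dots> \<longleftrightarrow> (\<forall>x\<in>eff_dom F. ?f xs + (- adjoint K ys) \<bullet> (x - xs) \<le> ?f x) \<and>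
      (\<forall>y\<in>eff_dom G. ?g ys + K xs \<bullet> (y - ys) \<le> ?g y)"
    by (simp add: inner_diff_right inner_adjoint[OF K] inner_commute[of "adjoint K ys"] algebra_simps)
  finally show ?thesis using xs ys by (simp add: subdifferential_real F G)
qed (auto simp: saddle_point_def subdifferential_def)

text \<open>In the optimality conditions the coupling is skew, so an explicit step of size \<open>s\<close> in it has the
  squared Lipschitz constant \<open>1 + s\<^sup>2\<parallel>K\<parallel>\<^sup>2\<close> only, without a term linear in \<open>s\<close>. The resolvents contract by
  \<open>1/(1 + s m)\<close>, which wins for small \<open>s\<close>; the Banach fixed point is a saddle-point.\<close>
lemma saddle_point_exists:
  fixes K :: "'a::{real_inner,complete_space} \<Rightarrow> 'b::{real_inner,complete_space}"
  assumes K: "bounded_linear K"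
    and F: "proper_fun F" "convex_fun F" "lsc_fun F" "strongly_convex_fun F \<mu>"
    and G: "proper_fun G" "convex_fun G" "lsc_fun G" "strongly_convex_fun G \<nu>"
    and pos: "\<mu> > 0" "\<nu> > 0"
  obtains xs ys where "saddle_point K F G xs ys"
proof -
  interpret K: bounded_linear K by fact
  interpret A: linear "adjoint K" by (rule linear_adjoint[OF K])
  note ia = inner_adjoint[OF K]
  define L where "L = onorm K"
  have L: "L \<ge> 0" "\<And>u. norm (K u) \<le> L * norm u" "\<And>v. norm (adjoint K v) \<le> L * norm v"
    unfolding L_def using onorm_pos_le[OF K] onorm[OF K] norm_adjoint_le[OF K] by auto
  define m where "m = min \<mu> \<nu>"
  have m: "m > 0" "m \<le> \<mu>" "m \<le> \<nu>" using pos by (auto simp: m_def)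
  \<comment> \<open>Any \<open>s > 0\<close> with \<open>s L\<^sup>2 < 2 m\<close> would do; adding \<open>1\<close> covers \<open>K = 0\<close>.\<close>
  define s where "s = m / (L\<^sup>2 + 1)"
  have L1: "L\<^sup>2 + 1 > 0" by (simp add: add_nonneg_pos)
  have s: "s > 0" using m L1 by (simp add: s_def)
  have "s * L\<^sup>2 \<le> m" using m L1 by (simp add: s_def field_simps)
  then have sL: "s * (s * L\<^sup>2) \<le> s * m" using s by simp
  define T where "T u = (resolvent s F (fst u - s *\<^sub>R adjoint K (snd u)),
    resolvent s G (snd u + s *\<^sub>R K (fst u)))" for u
  define c where "c = sqrt (1 + s\<^sup>2 * L\<^sup>2) / (1 + s * m)"
  have sm: "s * m > 0" using s m by simp
  have "1 + s\<^sup>2 * L\<^sup>2 < (1 + s * m)\<^sup>2"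
  proof -
    have "s\<^sup>2 * L\<^sup>2 \<le> s * m" using sL by (simp add: power2_eq_square mult.assoc)
    moreover have "(1 + s * m)\<^sup>2 = 1 + 2 * (s * m) + (s * m)\<^sup>2"
      by (simp add: power2_eq_square algebra_simps)
    moreover have "0 \<le> (s * m)\<^sup>2" by simp
    ultimately show ?thesis using sm by linarith
  qed
  then have "sqrt (1 + s\<^sup>2 * L\<^sup>2) < 1 + s * m" using sm by (intro real_less_lsqrt) auto
  then have c: "0 \<le> c" "c < 1" using sm by (auto simp: c_def)
  have contr: "dist (T u) (T w) \<le> c * dist u w" for u w
  proof -
    define a where "a = fst u - fst w"
    define h where "h = snd u - snd w"
    define p where "p = fst (T u) - fst (T w)"
    define q where "q = snd (T u) - snd (T w)"
    have "(1 + s * m) * norm p \<le> (1 + s * \<mu>) * norm p"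
      using s m by (intro mult_right_mono) auto
    also have "\<dots> \<le> norm ((fst u - s *\<^sub>R adjoint K (snd u)) - (fst w - s *\<^sub>R adjoint K (snd w)))"
      unfolding p_def T_def fst_conv by (rule resolvent_contraction[OF F s])
    also have "\<dots> = norm (a - s *\<^sub>R adjoint K h)"
      by (simp add: a_def h_def A.diff algebra_simps)
    finally have p: "((1 + s * m) * norm p)\<^sup>2 \<le> (norm (a - s *\<^sub>R adjoint K h))\<^sup>2"
      using sm by (intro power_mono) auto
    have "(1 + s * m) * norm q \<le> (1 + s * \<nu>) * norm q"
      using s m by (intro mult_right_mono) auto
    also have "\<dots> \<le> norm ((snd u + s *\<^sub>R K (fst u)) - (snd w + s *\<^sub>R K (fst w)))"
      unfolding q_def T_def snd_conv by (rule resolvent_contraction[OF G s])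
    also have "\<dots> = norm (h + s *\<^sub>R K a)"
      by (simp add: a_def h_def K.diff algebra_simps)
    finally have q: "((1 + s * m) * norm q)\<^sup>2 \<le> (norm (h + s *\<^sub>R K a))\<^sup>2"
      using sm by (intro power_mono) auto
    have "(norm (a - s *\<^sub>R adjoint K h))\<^sup>2 + (norm (h + s *\<^sub>R K a))\<^sup>2 =
        (norm a)\<^sup>2 + (norm h)\<^sup>2 + s\<^sup>2 * ((norm (adjoint K h))\<^sup>2 + (norm (K a))\<^sup>2)"
      unfolding power2_norm_eq_inner inner_diff_left inner_diff_right inner_add_left
        inner_add_right inner_scaleR_left inner_scaleR_right inner_commute[of "adjoint K h" a]
        inner_commute[of h "K a"] ia[of a h]
      by algebra
    moreover have "s\<^sup>2 * ((norm (adjoint K h))\<^sup>2 + (norm (K a))\<^sup>2) \<le>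
        s\<^sup>2 * ((L * norm h)\<^sup>2 + (L * norm a)\<^sup>2)"
      by (intro mult_left_mono add_mono power_mono L) auto
    ultimately have "(1 + s * m)\<^sup>2 * ((norm p)\<^sup>2 + (norm q)\<^sup>2) \<le>
        (1 + s\<^sup>2 * L\<^sup>2) * ((norm a)\<^sup>2 + (norm h)\<^sup>2)"
      using p[unfolded power_mult_distrib] q[unfolded power_mult_distrib]
      unfolding power_mult_distrib distrib_left distrib_right[of 1] by (simp add: mult_ac)
    then have "sqrt ((1 + s * m)\<^sup>2 * ((norm p)\<^sup>2 + (norm q)\<^sup>2)) \<le>
        sqrt ((1 + s\<^sup>2 * L\<^sup>2) * ((norm a)\<^sup>2 + (norm h)\<^sup>2))"
      by (rule real_sqrt_le_mono)
    moreover have "dist (T u) (T w) = sqrt ((norm p)\<^sup>2 + (norm q)\<^sup>2)"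
        "dist u w = sqrt ((norm a)\<^sup>2 + (norm h)\<^sup>2)"
      by (simp_all add: dist_prod_def dist_norm p_def q_def a_def h_def)
    ultimately have "(1 + s * m) * dist (T u) (T w) \<le> sqrt (1 + s\<^sup>2 * L\<^sup>2) * dist u w"
      using sm by (simp add: real_sqrt_mult)
    then show ?thesis using sm by (simp add: c_def field_simps)
  qed
  have "\<exists>!u. T u = u" using banach_fix_type[OF c, of T] contr by blast
  then obtain xs ys where fp: "T (xs, ys) = (xs, ys)" by (metis surj_pair)
  have "(1 / s) *\<^sub>R ((xs - s *\<^sub>R adjoint K ys) - xs) \<in> subdifferential F xs"
    using resolvent_subgradient[OF F(1-3) s, of "xs - s *\<^sub>R adjoint K ys"] fp by (simp add: T_def)
  moreover have "(1 / s) *\<^sub>R ((ys + s *\<^sub>R K xs) - ys) \<in> subdifferential G ys"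
    using resolvent_subgradient[OF G(1-3) s, of "ys + s *\<^sub>R K xs"] fp by (simp add: T_def)
  ultimately have "saddle_point K F G xs ys"
    unfolding saddle_point_iff_subgradients[OF K F(1) G(1)] using s by simp
  then show ?thesis by (rule that)
qed

text \<open>The skew coupling drops out when the optimality conditions of two saddle-points are subtracted and
  tested with the difference, so strong monotonicity forces the difference to vanish.\<close>
lemma saddle_point_unique:
  fixes K :: "'a::{real_inner,complete_space} \<Rightarrow> 'b::real_inner"
  assumes K: "bounded_linear K"
    and F: "proper_fun F" "strongly_convex_fun F \<mu>"
    and G: "proper_fun G" "strongly_convex_fun G \<nu>"
    and pos: "\<mu> > 0" "\<nu> > 0"
    and "saddle_point K F G x y" and "saddle_point K F G x' y'"
  shows "x = x' \<and> y = y'"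
proof -
  interpret K: bounded_linear K by fact
  interpret A: linear "adjoint K" by (rule linear_adjoint[OF K])
  note ia = inner_adjoint[OF K]
  have sub: "- adjoint K y \<in> subdifferential F x" "K x \<in> subdifferential G y"
      "- adjoint K y' \<in> subdifferential F x'" "K x' \<in> subdifferential G y'"
    using assms(8,9) saddle_point_iff_subgradients[OF K F(1) G(1)] by auto
  have "\<mu> * (norm (x - x'))\<^sup>2 + \<nu> * (norm (y - y'))\<^sup>2 \<le>
      (- adjoint K y - - adjoint K y') \<bullet> (x - x') + (K x - K x') \<bullet> (y - y')"
    using subdifferential_strongly_monotone[OF F sub(1,3)]
      subdifferential_strongly_monotone[OF G sub(2,4)] by linarith
  also have "- adjoint K y - - adjoint K y' = - adjoint K (y - y')" by (simp add: A.diff)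
  also have "- adjoint K (y - y') \<bullet> (x - x') + (K x - K x') \<bullet> (y - y') = 0"
    by (simp only: inner_minus_left inner_commute[of "adjoint K _"] ia K.diff)
  finally have "\<mu> * (norm (x - x'))\<^sup>2 + \<nu> * (norm (y - y'))\<^sup>2 \<le> 0" .
  moreover have "0 \<le> \<mu> * (norm (x - x'))\<^sup>2" "0 \<le> \<nu> * (norm (y - y'))\<^sup>2" using pos by auto
  ultimately have "\<mu> * (norm (x - x'))\<^sup>2 = 0" "\<nu> * (norm (y - y'))\<^sup>2 = 0" by linarith+
  then show ?thesis using pos by simp
qed

section \<open>Geometric decay of an energy\<close>

text \<open>One step in abstract form, with \<open>g = \<sigma>\<gamma>\<close>. The orthogonality relation is expanded into squares by the
  polarization identity, which leaves \<open>g \<parallel>Z' - z\<parallel>\<^sup>2\<close> as the only term of the wrong sign. Young's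
  inequality splits its bound into a part absorbed by the strong monotonicity and a part absorbed by
  \<open>\<parallel>Z' - Z\<parallel>\<^sup>2\<close>. The Young weight \<open>2\<mu>\<close> is the one built into the condition on \<open>g\<close>; with it, at most
  the fraction \<open>\<theta>\<^sup>2 < 1\<close> of \<open>\<parallel>Z' - Z\<parallel>\<^sup>2\<close> is used up.\<close>
lemma energy_decay:
  fixes z Z Z' :: "'h::real_inner"
  assumes mono: "\<mu> * (norm z)\<^sup>2 \<le> (Z - z) \<bullet> z"
    and orth: "(Z' - z) \<bullet> (z + \<theta> *\<^sub>R (Z' - Z)) = 0"
    and bound: "(norm (Z' - z))\<^sup>2 \<le> S * (norm (z + \<theta> *\<^sub>R (Z' - Z)))\<^sup>2"
    and pos: "\<mu> > 0" "S \<ge> 0" "g > 0" and step: "g * (1 + (1 + 2 * \<mu>) * S) \<le> 2 * \<mu>"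
    and \<theta>: "\<theta> = 1 / (1 + g)"
  shows "(norm Z')\<^sup>2 / \<theta> + (1 - \<theta>\<^sup>2) * (norm (Z' - Z))\<^sup>2 \<le> (norm Z)\<^sup>2"
proof -
  define D where "D = Z' - Z"
  define a where "a = 2 * \<mu>"
  have a: "a > 0" using pos by (simp add: a_def)
  have \<theta>g: "\<theta> * (1 + g) = 1" using pos \<theta> by simp
  have "0 \<le> (norm (a *\<^sub>R z - \<theta> *\<^sub>R D))\<^sup>2" by simp
  also have "\<dots> = a * ((1 + a) * (norm z)\<^sup>2) + (1 + a) * \<theta>\<^sup>2 * (norm D)\<^sup>2 - a * (norm (z + \<theta> *\<^sub>R D))\<^sup>2"
    unfolding power2_norm_eq_inner
    by (simp add: inner_diff_left inner_diff_right inner_add_left inner_add_right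
        inner_commute[of D z] power2_eq_square[of \<theta>] algebra_simps)
  finally have young: "a * (norm (z + \<theta> *\<^sub>R D))\<^sup>2 \<le>
      a * ((1 + a) * (norm z)\<^sup>2) + (1 + a) * \<theta>\<^sup>2 * (norm D)\<^sup>2" by simp
  have "a * (g * (norm (Z' - z))\<^sup>2) \<le> g * S * (a * (norm (z + \<theta> *\<^sub>R D))\<^sup>2)"
    using mult_left_mono[OF bound, of "a * g"] a pos by (simp add: D_def algebra_simps)
  also have "\<dots> \<le> g * S * (a * ((1 + a) * (norm z)\<^sup>2) + (1 + a) * \<theta>\<^sup>2 * (norm D)\<^sup>2)"
    using young pos by (intro mult_left_mono) auto
  also have "\<dots> = (g * S * (1 + a)) * (a * (norm z)\<^sup>2 + \<theta>\<^sup>2 * (norm D)\<^sup>2)"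
    by (simp add: algebra_simps)
  also have "\<dots> \<le> (a - g) * (a * (norm z)\<^sup>2 + \<theta>\<^sup>2 * (norm D)\<^sup>2)"
    using step a by (intro mult_right_mono) (auto simp: a_def algebra_simps)
  also have "\<dots> \<le> a * ((a - g) * (norm z)\<^sup>2) + a * (\<theta>\<^sup>2 * (norm D)\<^sup>2)"
    using pos by (simp add: algebra_simps)
  finally have "a * (g * (norm (Z' - z))\<^sup>2) \<le> a * ((a - g) * (norm z)\<^sup>2 + \<theta>\<^sup>2 * (norm D)\<^sup>2)"
    by (simp add: distrib_left)
  then have W: "g * (norm (Z' - z))\<^sup>2 \<le> (2 * \<mu> - g) * (norm z)\<^sup>2 + \<theta>\<^sup>2 * (norm D)\<^sup>2"
    using a by (simp add: a_def)
  have "0 = (1 + g) * ((Z' - z) \<bullet> (z + \<theta> *\<^sub>R D))" using orth by (simp add: D_def)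
  also have "\<dots> = (1 + g) * ((Z' - z) \<bullet> z) + (\<theta> * (1 + g)) * ((Z' - z) \<bullet> D)"
    by (simp add: inner_add_right algebra_simps)
  finally have orth': "(1 + g) * ((Z' - z) \<bullet> z) + (Z' - z) \<bullet> D = 0" using \<theta>g by simp
  have "(1 + g) * (norm Z')\<^sup>2 + (norm D)\<^sup>2 - (norm Z)\<^sup>2 =
      g * (norm (Z' - z))\<^sup>2 - 2 * ((Z - z) \<bullet> z) + g * (norm z)\<^sup>2
      + 2 * ((1 + g) * ((Z' - z) \<bullet> z) + (Z' - z) \<bullet> D)"
    unfolding power2_norm_eq_inner D_def
    by (simp add: inner_diff_left inner_diff_right inner_commute[of z Z] inner_commute[of z Z']
        inner_commute[of Z Z'] algebra_simps)
  then have "(1 + g) * (norm Z')\<^sup>2 + (norm D)\<^sup>2 - (norm Z)\<^sup>2 \<le> \<theta>\<^sup>2 * (norm D)\<^sup>2"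
    using orth' W mono by (simp add: algebra_simps)
  then show ?thesis using pos by (simp add: \<theta> D_def algebra_simps)
qed

text \<open>The energies scaled by \<open>\<theta>\<^sup>k\<close> decrease, so they converge, and the scaled increments, dominated by
  consecutive differences, vanish. Scaling the triangle inequality then gives \<open>\<surd>l \<le> \<surd>\<theta> \<surd>l\<close> for the limit
  \<open>l\<close> of the scaled energies.\<close>
lemma energy_decay_imp_little_o:
  fixes Z :: "nat \<Rightarrow> 'h::real_normed_vector"
  assumes \<theta>: "0 < \<theta>" "\<theta> < 1" and c: "c > 0"
    and decay: "\<And>k. (norm (Z (Suc k)))\<^sup>2 / \<theta> + c * (norm (Z (Suc k) - Z k))\<^sup>2 \<le> (norm (Z k))\<^sup>2"
  shows "(\<lambda>k. (norm (Z k))\<^sup>2 / \<theta> ^ k) \<longlonglongrightarrow> 0"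
proof -
  define e where "e k = (norm (Z k))\<^sup>2 / \<theta> ^ k" for k
  define \<delta> where "\<delta> k = (norm (Z (Suc k) - Z k))\<^sup>2 / \<theta> ^ k" for k
  have step: "e (Suc k) + c * \<delta> k \<le> e k" for k
    using divide_right_mono[OF decay[of k], of "\<theta> ^ k"] \<theta>
    by (simp add: e_def \<delta>_def add_divide_distrib)
  have pos: "e k \<ge> 0" "\<delta> k \<ge> 0" for k using \<theta> by (auto simp: e_def \<delta>_def)
  have "decseq e"
  proof (rule decseq_SucI)
    show "e (Suc k) \<le> e k" for k
      using step[of k] mult_nonneg_nonneg[of c "\<delta> k"] c pos(2)[of k] by linarith
  qed
  then obtain l where l: "e \<longlonglongrightarrow> l"
    using decseq_convergent[of e 0] pos by metis
  have "\<delta> \<longlonglongrightarrow> 0"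
  proof (rule tendsto_sandwich[OF _ _ tendsto_const])
    show "(\<lambda>k. (e k - e (Suc k)) / c) \<longlonglongrightarrow> 0"
      using tendsto_divide[OF tendsto_diff[OF l LIMSEQ_Suc[OF l]] tendsto_const[of c]] c by simp
    show "\<forall>\<^sub>F k in sequentially. \<delta> k \<le> (e k - e (Suc k)) / c"
    proof (rule always_eventually, rule allI)
      show "\<delta> k \<le> (e k - e (Suc k)) / c" for k
        using step[of k] c by (simp add: pos_le_divide_eq algebra_simps)
    qed
  qed (use pos in auto)
  have "sqrt (e k) \<le> sqrt \<theta> * sqrt (e (Suc k)) + sqrt (\<delta> k)" for k
  proof -
    have "norm (Z k) \<le> norm (Z (Suc k)) + norm (Z (Suc k) - Z k)"
      using norm_triangle_ineq4[of "Z (Suc k)" "Z (Suc k) - Z k"] by simp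
    then have "norm (Z k) / sqrt (\<theta> ^ k) \<le>
        norm (Z (Suc k)) / sqrt (\<theta> ^ k) + norm (Z (Suc k) - Z k) / sqrt (\<theta> ^ k)"
      using \<theta> by (simp add: divide_right_mono add_divide_distrib[symmetric])
    then show ?thesis using \<theta> by (simp add: e_def \<delta>_def real_sqrt_divide real_sqrt_mult)
  qed
  moreover have "(\<lambda>k. sqrt \<theta> * sqrt (e (Suc k)) + sqrt (\<delta> k)) \<longlonglongrightarrow> sqrt \<theta> * sqrt l + sqrt 0"
    by (intro tendsto_intros LIMSEQ_Suc[OF l] \<open>\<delta> \<longlonglongrightarrow> 0\<close>)
  moreover have "(\<lambda>k. sqrt (e k)) \<longlonglongrightarrow> sqrt l" by (intro tendsto_intros l)
  ultimately have "sqrt l \<le> sqrt \<theta> * sqrt l" using LIMSEQ_le by fastforce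
  moreover have "sqrt \<theta> < 1" using \<theta> by simp
  moreover have "0 \<le> l" using LIMSEQ_le_const[OF l] pos by blast
  ultimately have "l = 0"
    by (metis mult_le_cancel_right1 not_le order_antisym real_sqrt_eq_0_iff real_sqrt_ge_zero)
  then show ?thesis using l unfolding e_def by simp
qed

section \<open>The accelerated Douglas--Rachford iteration\<close>

text \<open>The vector \<open>d\<close> satisfies \<open>\<theta> d = x + \<theta> (xb' - xb)\<close>, the extrapolated primal point. Substituting it back
  undoes the elimination of \<open>yb'\<close> from the coupled linear system.\<close>
lemma aDRsc_implicit_updates:
  fixes K :: "'a::{real_inner,complete_space} \<Rightarrow> 'b::real_inner"
  assumes K: "bounded_linear K" and pos: "\<sigma> > 0" "\<tau> > 0" "\<theta> > 0"
    and it: "aDRsc_iteration K F G \<sigma> \<tau> \<theta> x y xb yb b d"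
  shows "xb (Suc k) = x (Suc k) - \<sigma> *\<^sub>R adjoint K (y (Suc k) + \<theta> *\<^sub>R (yb (Suc k) - yb k))"
    and "yb (Suc k) = y (Suc k) + \<tau> *\<^sub>R K (x (Suc k) + \<theta> *\<^sub>R (xb (Suc k) - xb k))"
proof -
  interpret K: bounded_linear K by fact
  interpret A: linear "adjoint K" by (rule linear_adjoint[OF K])
  let ?M = "\<lambda>u. u + (\<theta>\<^sup>2 * \<sigma> * \<tau>) *\<^sub>R adjoint K (K u)"
  let ?x = "x (Suc k)" and ?y = "y (Suc k)" and ?d = "d (Suc k)"
  have b: "b (Suc k) = (((1 + \<theta>) / \<theta>) *\<^sub>R ?x - xb k)
      - (\<theta> * \<sigma>) *\<^sub>R adjoint K (((1 + \<theta>) / \<theta>) *\<^sub>R ?y - yb k)"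
    and d: "?d = inv ?M (b (Suc k))"
    and xb: "xb (Suc k) = xb k - (1 / \<theta>) *\<^sub>R ?x + ?d"
    and yb: "yb (Suc k) = ?y + (\<theta> * \<tau>) *\<^sub>R K ?d"
    using it unfolding aDRsc_iteration_def by blast+
  have "surj ?M" using pos by (intro surj_id_plus_adjoint_comp[OF K]) simp
  then have "?M ?d = b (Suc k)" unfolding d by (rule surj_f_inv_f)
  then have Md: "?d = b (Suc k) - (\<theta>\<^sup>2 * \<sigma> * \<tau>) *\<^sub>R adjoint K (K ?d)" by (simp add: algebra_simps)
  have \<theta>d: "\<theta> *\<^sub>R ?d = ?x + \<theta> *\<^sub>R (xb (Suc k) - xb k)"
    unfolding xb using pos by (simp add: algebra_simps)
  have "yb (Suc k) = ?y + \<tau> *\<^sub>R K (\<theta> *\<^sub>R ?d)" by (simp add: yb K.scale mult.commute)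
  then show "yb (Suc k) = ?y + \<tau> *\<^sub>R K (?x + \<theta> *\<^sub>R (xb (Suc k) - xb k))"
    unfolding \<theta>d .
  have c: "(1 + \<theta>) / \<theta> = 1 + 1 / \<theta>" using pos by (simp add: field_simps)
  have "xb (Suc k) = xb k - (1 / \<theta>) *\<^sub>R ?x + (b (Suc k) - (\<theta>\<^sup>2 * \<sigma> * \<tau>) *\<^sub>R adjoint K (K ?d))"
    unfolding xb Md[symmetric] ..
  also have "\<dots> = ?x - (\<theta> * \<sigma>) *\<^sub>R adjoint K ((1 + 1 / \<theta>) *\<^sub>R ?y - yb k) - (\<theta>\<^sup>2 * \<sigma> * \<tau>) *\<^sub>R adjoint K (K ?d)"
    unfolding b c by (simp add: scaleR_add_left)
  also have "\<dots> = ?x - \<sigma> *\<^sub>R adjoint K (?y + \<theta> *\<^sub>R (yb (Suc k) - yb k))"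
    unfolding yb using pos
    by (simp add: A.add A.diff A.scale algebra_simps power2_eq_square)
  finally show "xb (Suc k) = ?x - \<sigma> *\<^sub>R adjoint K (?y + \<theta> *\<^sub>R (yb (Suc k) - yb k))" .
qed

text \<open>An embedding into the product space under which its norm becomes the weighted norm of the energy,
  so that the abstract estimates for inner product spaces apply.\<close>
definition weighted_pair :: "real \<Rightarrow> real \<Rightarrow> 'a::real_vector \<Rightarrow> 'b::real_vector \<Rightarrow> 'a \<times> 'b" where
  "weighted_pair \<sigma> \<tau> u v = ((1 / sqrt \<sigma>) *\<^sub>R u, (1 / sqrt \<tau>) *\<^sub>R v)"

lemma weighted_pair_linear:
  "weighted_pair \<sigma> \<tau> u v + weighted_pair \<sigma> \<tau> u' v' = weighted_pair \<sigma> \<tau> (u + u') (v + v')"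
  "weighted_pair \<sigma> \<tau> u v - weighted_pair \<sigma> \<tau> u' v' = weighted_pair \<sigma> \<tau> (u - u') (v - v')"
  "c *\<^sub>R weighted_pair \<sigma> \<tau> u v = weighted_pair \<sigma> \<tau> (c *\<^sub>R u) (c *\<^sub>R v)"
  by (simp_all add: weighted_pair_def scaleR_add_right scaleR_diff_right)

lemma inner_weighted_pair:
  assumes "\<sigma> > 0" "\<tau> > 0"
  shows "weighted_pair \<sigma> \<tau> u v \<bullet> weighted_pair \<sigma> \<tau> u' v' = (u \<bullet> u') / \<sigma> + (v \<bullet> v') / \<tau>"
  using assms by (simp add: weighted_pair_def)

lemma norm_weighted_pair:
  fixes u :: "'a::real_inner" and v :: "'b::real_inner"
  assumes "\<sigma> > 0" "\<tau> > 0"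
  shows "(norm (weighted_pair \<sigma> \<tau> u v))\<^sup>2 = (norm u)\<^sup>2 / \<sigma> + (norm v)\<^sup>2 / \<tau>"
  unfolding power2_norm_eq_inner by (rule inner_weighted_pair[OF assms])

text \<open>In the weighted inner product the condition \<open>\<sigma>\<gamma>\<^sub>1 = \<tau>\<gamma>\<^sub>2\<close> gives both components the same
  monotonicity constant, and \<open>\<langle>K\<^sup>* Q, P\<rangle> = \<langle>K P, Q\<rangle>\<close> makes the coupling terms cancel. Here \<open>p\<close>, \<open>q\<close>
  are the errors of the resolvent points and \<open>X\<close>, \<open>Y\<close>, \<open>X'\<close>, \<open>Y'\<close> those of the auxiliary points before and
  after the step.\<close>
lemma aDRsc_energy_decay:
  fixes K :: "'a::{real_inner,complete_space} \<Rightarrow> 'b::{real_inner,complete_space}"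
  assumes K: "bounded_linear K"
    and pos: "\<sigma> > 0" "\<tau> > 0" "\<gamma>\<^sub>1 > 0" "\<gamma> > 0" and balanced: "\<sigma> * \<gamma>\<^sub>1 = \<tau> * \<gamma>\<^sub>2"
    and \<gamma>: "\<gamma> \<le> 2 * \<gamma>\<^sub>1 / (1 + (1 + 2 * \<sigma> * \<gamma>\<^sub>1) * \<sigma> * \<tau> * (onorm K)\<^sup>2)"
    and \<theta>: "\<theta> = 1 / (1 + \<sigma> * \<gamma>)"
    and X': "X' = p - \<sigma> *\<^sub>R adjoint K (q + \<theta> *\<^sub>R (Y' - Y))"
    and Y': "Y' = q + \<tau> *\<^sub>R K (p + \<theta> *\<^sub>R (X' - X))"
    and p: "\<sigma> * \<gamma>\<^sub>1 * (norm p)\<^sup>2 \<le> (X - p) \<bullet> p"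
    and q: "\<tau> * \<gamma>\<^sub>2 * (norm q)\<^sup>2 \<le> (Y - q) \<bullet> q"
  shows "(norm (weighted_pair \<sigma> \<tau> X' Y'))\<^sup>2 / \<theta> +
      (1 - \<theta>\<^sup>2) * (norm (weighted_pair \<sigma> \<tau> X' Y' - weighted_pair \<sigma> \<tau> X Y))\<^sup>2
    \<le> (norm (weighted_pair \<sigma> \<tau> X Y))\<^sup>2"
proof -
  define L where "L = onorm K"
  have L: "L \<ge> 0" "\<And>u. norm (K u) \<le> L * norm u" "\<And>v. norm (adjoint K v) \<le> L * norm v"
    unfolding L_def using onorm_pos_le[OF K] onorm[OF K] norm_adjoint_le[OF K] by auto
  define P where "P = p + \<theta> *\<^sub>R (X' - X)"
  define Q where "Q = q + \<theta> *\<^sub>R (Y' - Y)"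
  have dX: "X' - p = - \<sigma> *\<^sub>R adjoint K Q" using X' by (simp add: Q_def)
  have dY: "Y' - q = \<tau> *\<^sub>R K P" using Y' by (simp add: P_def)
  define g where "g = \<sigma> * \<gamma>"
  define \<mu> where "\<mu> = \<sigma> * \<gamma>\<^sub>1"
  define S where "S = \<sigma> * \<tau> * L\<^sup>2"
  note ip = inner_weighted_pair[OF pos(1,2)] and nm = norm_weighted_pair[OF pos(1,2)]
  show ?thesis
  proof (rule energy_decay[where \<mu> = \<mu> and S = S and g = g and z = "weighted_pair \<sigma> \<tau> p q"])
    have "\<mu> * (norm p)\<^sup>2 / \<sigma> + \<mu> * (norm q)\<^sup>2 / \<tau> \<le> (X - p) \<bullet> p / \<sigma> + (Y - q) \<bullet> q / \<tau>"
      using p q pos balanced by (intro add_mono divide_right_mono) (auto simp: \<mu>_def)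
    then show "\<mu> * (norm (weighted_pair \<sigma> \<tau> p q))\<^sup>2 \<le>
        (weighted_pair \<sigma> \<tau> X Y - weighted_pair \<sigma> \<tau> p q) \<bullet> weighted_pair \<sigma> \<tau> p q"
      by (simp add: weighted_pair_linear ip nm distrib_left)
    have "adjoint K Q \<bullet> P = K P \<bullet> Q"
      using inner_adjoint[OF K, of P Q] by (simp add: inner_commute)
    then show "(weighted_pair \<sigma> \<tau> X' Y' - weighted_pair \<sigma> \<tau> p q) \<bullet>
        (weighted_pair \<sigma> \<tau> p q + \<theta> *\<^sub>R (weighted_pair \<sigma> \<tau> X' Y' - weighted_pair \<sigma> \<tau> X Y)) = 0"
      using pos by (simp add: weighted_pair_linear ip dX dY flip: P_def Q_def)
    have "(norm (adjoint K Q))\<^sup>2 \<le> (L * norm Q)\<^sup>2" "(norm (K P))\<^sup>2 \<le> (L * norm P)\<^sup>2"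
      by (intro power_mono L norm_ge_zero)+
    then have "\<sigma> * (norm (adjoint K Q))\<^sup>2 + \<tau> * (norm (K P))\<^sup>2 \<le> \<sigma> * (L * norm Q)\<^sup>2 + \<tau> * (L * norm P)\<^sup>2"
      using pos by (intro add_mono mult_left_mono) auto
    also have "\<dots> = S * ((norm P)\<^sup>2 / \<sigma> + (norm Q)\<^sup>2 / \<tau>)"
      using pos by (simp add: S_def power_mult_distrib field_simps)
    finally show "(norm (weighted_pair \<sigma> \<tau> X' Y' - weighted_pair \<sigma> \<tau> p q))\<^sup>2 \<le>
        S * (norm (weighted_pair \<sigma> \<tau> p q + \<theta> *\<^sub>R (weighted_pair \<sigma> \<tau> X' Y' - weighted_pair \<sigma> \<tau> X Y)))\<^sup>2"
      using pos
      by (simp add: weighted_pair_linear nm dX dY power_mult_distrib power2_eq_square[of \<sigma>]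
          power2_eq_square[of \<tau>] flip: P_def Q_def)
    show "\<mu> > 0" "S \<ge> 0" "g > 0" using pos by (auto simp: \<mu>_def S_def g_def)
    have "0 \<le> (1 + 2 * \<sigma> * \<gamma>\<^sub>1) * S" using pos by (simp add: S_def)
    then have "\<gamma> * (1 + (1 + 2 * \<sigma> * \<gamma>\<^sub>1) * S) \<le> 2 * \<gamma>\<^sub>1"
      using \<gamma> by (simp add: S_def L_def pos_le_divide_eq mult.assoc)
    then have "\<sigma> * (\<gamma> * (1 + (1 + 2 * \<sigma> * \<gamma>\<^sub>1) * S)) \<le> \<sigma> * (2 * \<gamma>\<^sub>1)" using pos by simp
    then show "g * (1 + (1 + 2 * \<mu>) * S) \<le> 2 * \<mu>"
      by (simp add: g_def \<mu>_def algebra_simps)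
    show "\<theta> = 1 / (1 + g)" by (simp add: \<theta> g_def)
  qed
qed

section \<open>Convergence\<close>

lemma sq_norm_little_o_geometric_imp_tendsto:
  fixes u :: "nat \<Rightarrow> 'c::real_normed_vector"
  assumes \<theta>: "0 < \<theta>" "\<theta> < 1" and o: "(\<lambda>k. (norm (u k - l))\<^sup>2) \<in> o(\<lambda>k. \<theta> ^ k)"
  shows "u \<longlonglongrightarrow> l"
proof -
  have "(\<lambda>k. (norm (u k - l))\<^sup>2 / \<theta> ^ k * \<theta> ^ k) \<longlonglongrightarrow> 0 * 0"
    using \<theta> by (intro tendsto_mult smalloD_tendsto[OF o] LIMSEQ_power_zero) auto
  then have "(\<lambda>k. sqrt ((norm (u k - l))\<^sup>2)) \<longlonglongrightarrow> sqrt 0"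
    using \<theta> by (intro tendsto_real_sqrt) simp
  then show ?thesis by (simp add: tendsto_norm_zero_iff LIM_zero_iff)
qed

lemma dominated_little_o_geometric:
  fixes f e :: "nat \<Rightarrow> real"
  assumes "0 < \<theta>" and e: "(\<lambda>k. e k / \<theta> ^ k) \<longlonglongrightarrow> 0" and "\<And>k. 0 \<le> f k" "\<And>k. f k \<le> C * e k"
  shows "f \<in> o(\<lambda>k. \<theta> ^ k)"
proof (rule smalloI_tendsto)
  show "(\<lambda>k. f k / \<theta> ^ k) \<longlonglongrightarrow> 0"
  proof (rule tendsto_sandwich[OF _ _ tendsto_const])
    show "(\<lambda>k. C * (e k / \<theta> ^ k)) \<longlonglongrightarrow> 0" by (rule tendsto_mult_right_zero[OF e])
  qed (use assms in \<open>auto intro!: divide_right_mono always_eventually\<close>)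
qed (use assms in auto)

lemma little_o_geometric_Suc:
  fixes f :: "nat \<Rightarrow> real"
  assumes "0 < \<theta>" and "(\<lambda>k. f (Suc k)) \<in> o(\<lambda>k. \<theta> ^ k)"
  shows "f \<in> o(\<lambda>k. \<theta> ^ k)"
proof (rule smalloI_tendsto)
  have "(\<lambda>k. f (Suc k) / \<theta> ^ k / \<theta>) \<longlonglongrightarrow> 0 / \<theta>"
    using assms by (intro tendsto_divide smalloD_tendsto) auto
  then have "(\<lambda>k. f (Suc k) / \<theta> ^ Suc k) \<longlonglongrightarrow> 0" by (simp add: mult.commute)
  then show "(\<lambda>k. f k / \<theta> ^ k) \<longlonglongrightarrow> 0" by (rule LIMSEQ_imp_Suc)
qed (use assms in auto)

theorem theorem4:
  fixes K :: "'a::{real_inner, complete_space} \<Rightarrow> 'b::{real_inner, complete_space}"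
    and F :: "'a \<Rightarrow> ereal" and G :: "'b \<Rightarrow> ereal"
    and \<gamma>\<^sub>1 \<gamma>\<^sub>2 \<sigma> \<tau> \<gamma> \<theta> :: real
    and x xb b d :: "nat \<Rightarrow> 'a" and y yb :: "nat \<Rightarrow> 'b"
  assumes "bounded_linear K"
    and "proper_fun F" and "convex_fun F" and "lsc_fun F"
    and "proper_fun G" and "convex_fun G" and "lsc_fun G"
    and "\<gamma>\<^sub>1 > 0" and "strongly_convex_fun F \<gamma>\<^sub>1"
    and "\<gamma>\<^sub>2 > 0" and "strongly_convex_fun G \<gamma>\<^sub>2"
    and "\<sigma> > 0" and "\<tau> > 0" and "\<sigma> * \<gamma>\<^sub>1 = \<tau> * \<gamma>\<^sub>2"
    and "\<gamma> > 0" and "\<gamma> \<le> 2 * \<gamma>\<^sub>1 / (1 + (1 + 2 * \<sigma> * \<gamma>\<^sub>1) * \<sigma> * \<tau> * (onorm K)\<^sup>2)"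
    and "\<theta> = 1 / (1 + \<sigma> * \<gamma>)"
    and "aDRsc_iteration K F G \<sigma> \<tau> \<theta> x y xb yb b d"
  shows "\<exists>xs ys.
      (\<forall>x' y'. saddle_point K F G x' y' \<longleftrightarrow> x' = xs \<and> y' = ys) \<and>
      (\<lambda>k. (x k, y k)) \<longlonglongrightarrow> (xs, ys) \<and>
      (\<lambda>k. (norm (x k - xs))\<^sup>2) \<in> o(\<lambda>k. \<theta> ^ k) \<and>
      (\<lambda>k. (norm (y k - ys))\<^sup>2) \<in> o(\<lambda>k. \<theta> ^ k) \<and>
      (let xbs = xs - \<sigma> *\<^sub>R adjoint K ys; ybs = ys + \<tau> *\<^sub>R K xs in
        (\<lambda>k. (xb k, yb k)) \<longlonglongrightarrow> (xbs, ybs) \<and>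
        (\<lambda>k. (norm (xb k - xbs))\<^sup>2) \<in> o(\<lambda>k. \<theta> ^ k) \<and>
        (\<lambda>k. (norm (yb k - ybs))\<^sup>2) \<in> o(\<lambda>k. \<theta> ^ k))"
proof -
  note K = assms(1) and F = assms(2,3,4,9) and G = assms(5,6,7,11)
  note \<sigma> = assms(12) and \<tau> = assms(13) and it = assms(18)
  interpret K: bounded_linear K by fact
  interpret A: linear "adjoint K" by (rule linear_adjoint[OF K])
  have \<sigma>\<gamma>: "\<sigma> * \<gamma> > 0" using \<sigma> assms(15) by simp
  have \<theta>: "0 < \<theta>" "\<theta> < 1" using \<sigma>\<gamma> by (auto simp: assms(17))
  obtain xs ys where saddle: "saddle_point K F G xs ys"
    using saddle_point_exists[OF K F G assms(8,10)] by blast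
  then have unique: "saddle_point K F G x' y' \<longleftrightarrow> x' = xs \<and> y' = ys" for x' y'
    using saddle_point_unique[OF K F(1,4) G(1,4) assms(8,10)] by blast
  define xbs where "xbs = xs - \<sigma> *\<^sub>R adjoint K ys"
  define ybs where "ybs = ys + \<tau> *\<^sub>R K xs"
  have sub: "- adjoint K ys \<in> subdifferential F xs" "K xs \<in> subdifferential G ys"
    using saddle saddle_point_iff_subgradients[OF K F(1) G(1)] by auto
  have rF: "resolvent \<sigma> F xbs = xs"
    by (rule resolvent_eqI[OF F(1,2) \<sigma> sub(1)]) (simp add: xbs_def)
  have rG: "resolvent \<tau> G ybs = ys"
    by (rule resolvent_eqI[OF G(1,2) \<tau> sub(2)]) (simp add: ybs_def)
  have x: "x (Suc k) = resolvent \<sigma> F (xb k)" and y: "y (Suc k) = resolvent \<tau> G (yb k)" for k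
    using it unfolding aDRsc_iteration_def by blast+
  note upd = aDRsc_implicit_updates[OF K \<sigma> \<tau> \<theta>(1) it]
  define Z where "Z k = weighted_pair \<sigma> \<tau> (xb k - xbs) (yb k - ybs)" for k
  have decay: "(norm (Z (Suc k)))\<^sup>2 / \<theta> + (1 - \<theta>\<^sup>2) * (norm (Z (Suc k) - Z k))\<^sup>2 \<le> (norm (Z k))\<^sup>2" for k
    unfolding Z_def
  proof (rule aDRsc_energy_decay[OF K \<sigma> \<tau> assms(8,15,14,16,17),
        where p = "x (Suc k) - xs" and q = "y (Suc k) - ys"])
    have "adjoint K (y (Suc k) - ys + \<theta> *\<^sub>R (yb (Suc k) - ybs - (yb k - ybs))) =
        adjoint K (y (Suc k) + \<theta> *\<^sub>R (yb (Suc k) - yb k)) - adjoint K ys"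
      by (simp add: A.diff[symmetric] algebra_simps)
    then show "xb (Suc k) - xbs = x (Suc k) - xs -
        \<sigma> *\<^sub>R adjoint K (y (Suc k) - ys + \<theta> *\<^sub>R (yb (Suc k) - ybs - (yb k - ybs)))"
      by (simp only:) (subst upd(1), simp add: xbs_def scaleR_diff_right)
    have "K (x (Suc k) - xs + \<theta> *\<^sub>R (xb (Suc k) - xbs - (xb k - xbs))) =
        K (x (Suc k) + \<theta> *\<^sub>R (xb (Suc k) - xb k)) - K xs"
      by (simp add: K.diff[symmetric] algebra_simps)
    then show "yb (Suc k) - ybs = y (Suc k) - ys +
        \<tau> *\<^sub>R K (x (Suc k) - xs + \<theta> *\<^sub>R (xb (Suc k) - xbs - (xb k - xbs)))"
      by (simp only:) (subst upd(2), simp add: ybs_def scaleR_diff_right)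
    show "\<sigma> * \<gamma>\<^sub>1 * (norm (x (Suc k) - xs))\<^sup>2 \<le> (xb k - xbs - (x (Suc k) - xs)) \<bullet> (x (Suc k) - xs)"
      by (rule resolvent_strongly_monotone[OF F \<sigma>]) (simp add: x rF)
    show "\<tau> * \<gamma>\<^sub>2 * (norm (y (Suc k) - ys))\<^sup>2 \<le> (yb k - ybs - (y (Suc k) - ys)) \<bullet> (y (Suc k) - ys)"
      by (rule resolvent_strongly_monotone[OF G \<tau>]) (simp add: y rG)
  qed
  have "1 - \<theta>\<^sup>2 > 0" using \<theta> by (simp add: power_less_one_iff)
  then have Z0: "(\<lambda>k. (norm (Z k))\<^sup>2 / \<theta> ^ k) \<longlonglongrightarrow> 0"
    using decay by (rule energy_decay_imp_little_o[OF \<theta>])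
  have xb_le: "(norm (xb k - xbs))\<^sup>2 \<le> \<sigma> * (norm (Z k))\<^sup>2"
    and yb_le: "(norm (yb k - ybs))\<^sup>2 \<le> \<tau> * (norm (Z k))\<^sup>2" for k
    using \<sigma> \<tau> by (simp_all add: Z_def norm_weighted_pair distrib_left)
  have "(norm (x (Suc k) - xs))\<^sup>2 \<le> (norm (xb k - xbs))\<^sup>2" for k
    using resolvent_contraction[OF F(1-3) convex_imp_strongly_convex_0[OF F(2)] \<sigma>, of "xb k" xbs]
    by (simp add: x rF)
  then have x_le: "(norm (x (Suc k) - xs))\<^sup>2 \<le> \<sigma> * (norm (Z k))\<^sup>2" for k
    using xb_le order_trans by blast
  have "(norm (y (Suc k) - ys))\<^sup>2 \<le> (norm (yb k - ybs))\<^sup>2" for k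
    using resolvent_contraction[OF G(1-3) convex_imp_strongly_convex_0[OF G(2)] \<tau>, of "yb k" ybs]
    by (simp add: y rG)
  then have y_le: "(norm (y (Suc k) - ys))\<^sup>2 \<le> \<tau> * (norm (Z k))\<^sup>2" for k
    using yb_le order_trans by blast
  note dom = dominated_little_o_geometric[OF \<theta>(1) Z0]
  have o: "(\<lambda>k. (norm (x k - xs))\<^sup>2) \<in> o(\<lambda>k. \<theta> ^ k)"
      "(\<lambda>k. (norm (y k - ys))\<^sup>2) \<in> o(\<lambda>k. \<theta> ^ k)"
      "(\<lambda>k. (norm (xb k - xbs))\<^sup>2) \<in> o(\<lambda>k. \<theta> ^ k)"
      "(\<lambda>k. (norm (yb k - ybs))\<^sup>2) \<in> o(\<lambda>k. \<theta> ^ k)"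
    using little_o_geometric_Suc[OF \<theta>(1) dom[OF zero_le_power2 x_le]]
      little_o_geometric_Suc[OF \<theta>(1) dom[OF zero_le_power2 y_le]]
      dom[OF zero_le_power2 xb_le] dom[OF zero_le_power2 yb_le]
    by blast+
  note tendsto = o[THEN sq_norm_little_o_geometric_imp_tendsto[OF \<theta>]]
  show ?thesis
    unfolding Let_def using unique o tendsto unfolding xbs_def ybs_def
    by (intro exI[of _ xs] exI[of _ ys] conjI allI tendsto_Pair) auto
qed

end
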